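(* Consider the problem $\min_{x\in X} f(x)$ s.t. $g(x)\le 0$, $h(x)=0$, $x\in C$ with feasible set $\mathcal F:=\{x\in C\mid g(x)\le 0,\ h(x)=0\}$, in the setting described in the context, and assume $\operatorname{dom} f\cap\mathcal F\neq\emptyset$. Assume that the safeguarded augmented Lagrangian method (described in the context) produces an infinite sequence $\{x^k\}$ such that, for some sequence $\{\varepsilon_k\}\subset[0,\infty)$ with $\varepsilon_k\to 0$, one has for each iteration $k\in\mathbb N$ $$\forall x\in C:\quad L_{\rho_k}(x^{k+1},v^k,w^k)-\varepsilon_k\le L_{\rho_k}(x,v^k,w^k).$$ Then, for each subsequence $\{x^{k+1}\}_{k\in K}$ ($K\subset\mathbb N$ infinite) and each point $\bar x\in X$ such that $x^{k+1}\rightharpoonup\bar x$ weakly in $X$ as $k\to\infty$ in $K$, we have $f(x^{k+1})\to f(\bar x)$ as $k\to\infty$ in $K$, and $\bar x$ is a global minimizer of the problem, i.e., $\bar x\in\mathcal F$ and $f(\bar x)\le f(x)$ for all $x\in\mathcal F$.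
   Context: Let $\overline{\mathbb R}:=\mathbb R\cup\{\infty\}$ and $\operatorname{dom}\varphi:=\{x\mid\varphi(x)<\infty\}$. Setting: $X$ is a reflexive Banach space (real), $Y$ is a real Hilbert space with inner product $(\cdot,\cdot)_Y$, $C\subset X$ is weakly sequentially closed, $f\colon X\to\overline{\mathbb R}$ and $g=(g_1,\dots,g_m)\colon X\to\overline{\mathbb R}^m$ are such that $f,g_1,\dots,g_m$ are weakly sequentially lower semicontinuous, and $h\colon X\to Y$ is weakly-strongly sequentially continuous, i.e., $x^k\rightharpoonup x$ in $X$ implies $h(x^k)\to h(x)$ in norm in $Y$. Put $\operatorname{dom} g:=\bigcap_{i=1}^m\operatorname{dom} g_i$. Augmented Lagrangian: for $\rho>0$, $x\in X$, $\lambda\in\mathbb R^m_+$, $\mu\in Y$, $$L_\rho(x,\lambda,\mu):=f(x)+\frac1{2\rho}\sum_{i=1}^m\left(\max(0,\lambda_i+\rho g_i(x))^2-\lambda_i^2\right)+(\mu,h(x))_Y+\frac\rho2\|h(x)\|_Y^2,$$ where the term $\max(0,\lambda_i+\rho g_i(x))^2$ equals $\infty$ if $g_i(x)=\infty$. Error measure: for $\rho>0$, $x\in X$, $\lambda\in\mathbb R^m_+$, $V_\rho(x,\lambda):=\max\left(\|\max(g(x),-\lambda/\rho)\|_\infty,\|h(x)\|_Y\right)$ (componentwise maximum inside the norm) if $x\in\operatorname{dom} g$, and $V_\rho(x,\lambda):=\infty$ otherwise. Safeguarded augmented Lagrangian method: fix bounded sets $B_m\subset\mathbb R^m_+$ and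 $B_Y\subset Y$, a starting point $x^0\in C$, $\rho_0>0$, $\tau\in(0,1)$, $\gamma>1$. In iteration $k=0,1,2,\dots$: choose arbitrary $v^k\in B_m$ and $w^k\in B_Y$; compute $x^{k+1}\in C$ as an approximate solution of $\min_{x\in C}L_{\rho_k}(x,v^k,w^k)$ (the required accuracy is the inequality in the claim); if $k=0$ or $V_{\rho_k}(x^{k+1},v^k)\le\tau V_{\rho_{k-1}}(x^k,v^{k-1})$, set $\rho_{k+1}:=\rho_k$, otherwise set $\rho_{k+1}:=\gamma\rho_k$. (The method also records multipliers $\lambda^{k+1}:=\max(0,v^k+\rho_kg(x^{k+1}))$ and $\mu^{k+1}:=w^k+\rho_kh(x^{k+1})$, which may be used in choosing $v^{k+1},w^{k+1}$.) The method is considered without termination, so it produces infinite sequences. *)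

theory Defs
  imports "HOL-Analysis.Analysis"
begin

text \<open>
  Functions into \<open>\<real> \<union> {\<infinity>}\<close> are modelled as \<^typ>\<open>ereal\<close>-valued functions that avoid \<open>-\<infinity>\<close>.
\<close>

definition avoids_minus_infinity :: "('a \<Rightarrow> ereal) \<Rightarrow> bool" where
  "avoids_minus_infinity \<phi> \<longleftrightarrow> (\<forall>x. \<phi> x \<noteq> -\<infinity>)"

definition edom :: "('a \<Rightarrow> ereal) \<Rightarrow> 'a set" where
  "edom \<phi> = {x. \<phi> x < \<infinity>}"

definition edom_vec :: "('a \<Rightarrow> ereal ^ 'm::finite) \<Rightarrow> 'a set" where
  "edom_vec g = (\<Inter>i. edom (\<lambda>x. g x $ i))"

text \<open>Reflexivity: the canonical embedding of the space into its bidual is onto.\<close>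

definition reflexive_space :: "'a::banach itself \<Rightarrow> bool" where
  "reflexive_space _ \<longleftrightarrow>
     (\<forall>\<Phi> :: ('a \<Rightarrow>\<^sub>L real) \<Rightarrow>\<^sub>L real. \<exists>x :: 'a. \<forall>\<phi>. blinfun_apply \<Phi> \<phi> = blinfun_apply \<phi> x)"

definition weakly_tendsto :: "(nat \<Rightarrow> 'a::real_normed_vector) \<Rightarrow> 'a \<Rightarrow> bool" where
  "weakly_tendsto X l \<longleftrightarrow>
     (\<forall>\<phi> :: 'a \<Rightarrow>\<^sub>L real. (\<lambda>n. blinfun_apply \<phi> (X n)) \<longlonglongrightarrow> blinfun_apply \<phi> l)"

definition weakly_seq_closed :: "'a::real_normed_vector set \<Rightarrow> bool" where
  "weakly_seq_closed C \<longleftrightarrow> (\<forall>X l. (\<forall>n. X n \<in> C) \<longrightarrow> weakly_tendsto X l \<longrightarrow> l \<in> C)"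

definition weakly_seq_lsc :: "('a::real_normed_vector \<Rightarrow> ereal) \<Rightarrow> bool" where
  "weakly_seq_lsc \<phi> \<longleftrightarrow> (\<forall>X l. weakly_tendsto X l \<longrightarrow> \<phi> l \<le> liminf (\<lambda>n. \<phi> (X n)))"

definition weakly_strongly_seq_continuous ::
  "('a::real_normed_vector \<Rightarrow> 'b::real_normed_vector) \<Rightarrow> bool" where
  "weakly_strongly_seq_continuous h \<longleftrightarrow>
     (\<forall>X l. weakly_tendsto X l \<longrightarrow> (\<lambda>n. h (X n)) \<longlonglongrightarrow> h l)"

definition feasible_set ::
  "'a set \<Rightarrow> ('a \<Rightarrow> ereal ^ 'm::finite) \<Rightarrow> ('a \<Rightarrow> 'b::zero) \<Rightarrow> 'a set" where
  "feasible_set C g h = {x \<in> C. (\<forall>i. g x $ i \<le> 0) \<and> h x = 0}"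

definition aug_lagrangian ::
  "('a \<Rightarrow> ereal) \<Rightarrow> ('a \<Rightarrow> ereal ^ 'm::finite) \<Rightarrow> ('a \<Rightarrow> 'b::real_inner) \<Rightarrow>
     real \<Rightarrow> 'a \<Rightarrow> real ^ 'm \<Rightarrow> 'b \<Rightarrow> ereal" where
  "aug_lagrangian f g h \<rho> x l \<mu> =
     f x
     + ereal (1 / (2 * \<rho>)) *
         (\<Sum>i\<in>UNIV. (max 0 (ereal (l $ i) + ereal \<rho> * g x $ i))\<^sup>2 - ereal ((l $ i)\<^sup>2))
     + ereal (\<mu> \<bullet> h x) + ereal (\<rho> / 2 * (norm (h x))\<^sup>2)"

text \<open>
  The convention for the penalty term at points outside the domain of a constraint function
  is automatic from \<^typ>\<open>ereal\<close> arithmetic.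
\<close>

lemma penalty_term_infinite:
  assumes "\<rho> > 0" "y = \<infinity>"
  shows "(max 0 (ereal l + ereal \<rho> * y))\<^sup>2 = \<infinity>"
  using assms by (simp add: power2_eq_square max_def)

text \<open>
  The first case is taken exactly when every component of \<^term>\<open>g x\<close> is a real number,
  provided the components avoid \<open>-\<infinity>\<close>. \<^const>\<open>infnorm\<close> is the maximum norm.
\<close>

definition error_measure ::
  "('a \<Rightarrow> ereal ^ 'm::finite) \<Rightarrow> ('a \<Rightarrow> 'b::real_normed_vector) \<Rightarrow>
     real \<Rightarrow> 'a \<Rightarrow> real ^ 'm \<Rightarrow> ereal" where
  "error_measure g h \<rho> x l =
     (if x \<in> edom_vec g
      then ereal (max (infnorm (\<chi> i. max (real_of_ereal (g x $ i)) (- (l $ i) / \<rho>)))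
                      (norm (h x)))
      else \<infinity>)"

text \<open>
  A run of the safeguarded augmented Lagrangian method with iterates \<open>x\<close>, safeguarded multipliers
  \<open>v\<close>, \<open>w\<close> and penalty parameters \<open>\<rho>\<close>. The accuracy required of the subproblem solutions is not
  part of this predicate. The multipliers \<open>max 0 (v k + \<rho> k * g (x (Suc k)))\<close> and
  \<open>w k + \<rho> k * h (x (Suc k))\<close> need not be recorded: \<open>v\<close> and \<open>w\<close> are arbitrary
  in \<open>Bm\<close> and \<open>BY\<close>, so they may depend on them in any way.
\<close>

definition safeguarded_alm_run ::
  "'a set \<Rightarrow> ('a \<Rightarrow> ereal ^ 'm::finite) \<Rightarrow> ('a \<Rightarrow> 'b::real_inner) \<Rightarrow>
     (real ^ 'm) set \<Rightarrow> 'b set \<Rightarrow> real \<Rightarrow> real \<Rightarrow>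
     (nat \<Rightarrow> 'a) \<Rightarrow> (nat \<Rightarrow> real ^ 'm) \<Rightarrow> (nat \<Rightarrow> 'b) \<Rightarrow> (nat \<Rightarrow> real) \<Rightarrow> bool" where
  "safeguarded_alm_run C g h Bm BY \<tau> \<gamma> x v w \<rho> \<longleftrightarrow>
     x 0 \<in> C \<and> \<rho> 0 > 0 \<and>
     (\<forall>k. v k \<in> Bm \<and> w k \<in> BY \<and> x (Suc k) \<in> C \<and>
        \<rho> (Suc k) =
          (if k = 0 \<or>
              error_measure g h (\<rho> k) (x (Suc k)) (v k)
                \<le> ereal \<tau> * error_measure g h (\<rho> (k - 1)) (x k) (v (k - 1))
           then \<rho> k else \<gamma> * \<rho> k))"

end

theory Submission
  imports Defs
begin

text \<open>
  At a feasible point the augmented Lagrangian is at most \<open>f\<close>, so the subproblem inequality bounds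
  \<open>L (x (k + 1))\<close> by \<open>f y + \<epsilon> k\<close> for every feasible \<open>y\<close>. If \<open>\<rho>\<close> is eventually constant, the error
  measure contracts, so feasibility holds in the limit and the penalty term
  \<open>\<Sum>i. v i * u i + \<rho> / 2 * (u i)\<^sup>2\<close> with \<open>u = max (g x) (- v / \<rho>) \<longrightarrow> 0\<close> is asymptotically
  nonnegative. Otherwise \<open>\<rho> \<longrightarrow> \<infinity>\<close>; as \<open>f\<close> is bounded below along the weakly convergent
  subsequence, the penalty terms are bounded, the constraint violations are of order
  \<open>1 / sqrt \<rho>\<close>, and the penalty term is at least \<open>- |v|\<^sup>2 / (2 * \<rho>)\<close>. In both cases
  \<open>limsup f (x (k + 1)) \<le> f y\<close> for all feasible \<open>y\<close>, including the weak limit, and weak lower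
  semicontinuity gives the rest.
\<close>

text \<open>At points with finite values the computation moves from \<open>ereal\<close> to real
  arithmetic, where terms can be rearranged freely.\<close>

lemma aug_lagrangian_eq_real:
  fixes g :: "'a \<Rightarrow> ereal ^ 'm::finite"
  assumes "f x = ereal a" and "\<And>i. g x $ i = ereal (G i)"
  shows "aug_lagrangian f g h \<rho> x l \<mu> =
    ereal (a + 1 / (2 * \<rho>) * (\<Sum>i\<in>UNIV. (max 0 (l $ i + \<rho> * G i))\<^sup>2 - (l $ i)\<^sup>2)
      + \<mu> \<bullet> h x + \<rho> / 2 * (norm (h x))\<^sup>2)"
proof -
  have "(max 0 (ereal (l $ i) + ereal \<rho> * g x $ i))\<^sup>2 - ereal ((l $ i)\<^sup>2)
      = ereal ((max 0 (l $ i + \<rho> * G i))\<^sup>2 - (l $ i)\<^sup>2)" for i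
    by (simp add: assms zero_ereal_def flip: ereal_max)
  then show ?thesis
    by (simp add: aug_lagrangian_def assms)
qed

text \<open>An infinite summand absorbs all others in \<open>ereal\<close>. Hence an upper bound on
  the Lagrangian at an iterate forces finite objective and constraint values there.\<close>

lemma aug_lagrangian_finiteD:
  fixes g :: "'a \<Rightarrow> ereal ^ 'm::finite"
  assumes "\<rho> > 0" and "f x \<noteq> -\<infinity>"
    and fin: "aug_lagrangian f g h \<rho> x l \<mu> \<noteq> \<infinity>"
  shows "f x \<noteq> \<infinity>" and "g x $ i \<noteq> \<infinity>"
proof -
  show "f x \<noteq> \<infinity>"
    using fin by (auto simp: aug_lagrangian_def)
  show "g x $ i \<noteq> \<infinity>"
  proof
    assume "g x $ i = \<infinity>"
    then have "(max 0 (ereal (l $ i) + ereal \<rho> * g x $ i))\<^sup>2 - ereal ((l $ i)\<^sup>2) = \<infinity>"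
      using penalty_term_infinite[OF \<open>\<rho> > 0\<close>] by simp
    then have "(\<Sum>i\<in>UNIV. (max 0 (ereal (l $ i) + ereal \<rho> * g x $ i))\<^sup>2 - ereal ((l $ i)\<^sup>2)) = \<infinity>"
      by (auto simp: sum_Pinfty)
    then show False
      using fin \<open>\<rho> > 0\<close> \<open>f x \<noteq> -\<infinity>\<close> by (simp add: aug_lagrangian_def)
  qed
qed

text \<open>For \<open>g y $ i\<close> \<le> 0 and \<open>l $ i\<close> \<ge> 0 the truncated term
  lies between 0 and \<open>l $ i\<close>, so each penalty summand is nonpositive; the terms with
  \<open>h\<close> vanish.\<close>

lemma aug_lagrangian_feasible_le:
  fixes g :: "'a \<Rightarrow> ereal ^ 'm::finite"
  assumes "\<rho> > 0" and "y \<in> feasible_set C g h"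
    and f: "f y = ereal a" and g: "\<And>i. g y $ i \<noteq> -\<infinity>" and l: "\<And>i. l $ i \<ge> 0"
  shows "aug_lagrangian f g h \<rho> y l \<mu> \<le> f y"
proof -
  define G where "G i = real_of_ereal (g y $ i)" for i
  have le: "g y $ i \<le> 0" for i
    using assms(2) by (simp add: feasible_set_def)
  have G: "g y $ i = ereal (G i)" for i
    using g[of i] le[of i] by (cases "g y $ i") (auto simp: G_def)
  have "max 0 (l $ i + \<rho> * G i) \<le> l $ i" for i
    using le[of i] \<open>\<rho> > 0\<close> l[of i] by (simp add: G mult_nonneg_nonpos)
  then have "(max 0 (l $ i + \<rho> * G i))\<^sup>2 \<le> (l $ i)\<^sup>2" for i
    by (intro power_mono) auto
  then have "(\<Sum>i\<in>UNIV. (max 0 (l $ i + \<rho> * G i))\<^sup>2 - (l $ i)\<^sup>2) \<le> 0"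
    by (intro sum_nonpos) simp
  then have "1 / (2 * \<rho>) * (\<Sum>i\<in>UNIV. (max 0 (l $ i + \<rho> * G i))\<^sup>2 - (l $ i)\<^sup>2) \<le> 0"
    using \<open>\<rho> > 0\<close> by (intro mult_nonneg_nonpos) auto
  moreover have "h y = 0"
    using assms(2) by (simp add: feasible_set_def)
  ultimately show ?thesis
    by (simp add: aug_lagrangian_eq_real[of f y a g G, OF f G] f)
qed

text \<open>\<open>P\<close> abstracts the test that keeps the penalty parameter. Each failure
  contributes a factor \<gamma> > 1 and nothing decreases \<rho>, so infinitely many failures make
  it exceed every bound.\<close>

lemma penalty_parameter_cases:
  fixes \<rho> :: "nat \<Rightarrow> real"
  assumes "\<rho> 0 > 0" and "\<gamma> > 1"
    and step: "\<And>k. \<rho> (Suc k) = (if P k then \<rho> k else \<gamma> * \<rho> k)"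
  shows "\<rho> k \<ge> \<rho> 0" and "(\<exists>N. \<forall>k\<ge>N. P k) \<or> filterlim \<rho> at_top sequentially"
proof -
  have pos: "\<rho> k > 0" for k
    by (induction k) (use assms in auto)
  have inc: "incseq \<rho>"
    using pos \<open>\<gamma> > 1\<close> by (intro incseq_SucI) (simp add: step)
  then show "\<rho> k \<ge> \<rho> 0"
    by (simp add: incseqD)
  show "(\<exists>N. \<forall>k\<ge>N. P k) \<or> filterlim \<rho> at_top sequentially"
  proof (rule disjCI)
    assume "\<not> filterlim \<rho> at_top sequentially"
    then obtain B where not_ev: "\<not> (\<forall>\<^sub>F k in sequentially. B \<le> \<rho> k)"
      by (auto simp: filterlim_at_top)
    \<comment> \<open>Monotonicity turns "not eventually at least \<open>B\<close>" into "always
      below \<open>B\<close>".\<close>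
    have B: "\<rho> k < B" for k
    proof (rule ccontr)
      assume "\<not> \<rho> k < B"
      then have "\<forall>j\<ge>k. B \<le> \<rho> j"
        using incseqD[OF inc] by (metis linorder_not_le order_trans)
      then show False
        using not_ev by (auto simp: eventually_sequentially)
    qed
    show "\<exists>N. \<forall>k\<ge>N. P k"
    proof (rule ccontr)
      assume "\<not> ?thesis"
      then have ex: "\<exists>k\<ge>N. \<not> P k" for N
        by blast
      \<comment> \<open>Here \<open>n\<close> counts failures: the induction step moves on to the
        next index at which \<open>P\<close> fails.\<close>
      have "\<exists>k. \<gamma> ^ n * \<rho> 0 \<le> \<rho> k" for n
      proof (induction n)
        case (Suc n)
        then obtain k where k: "\<gamma> ^ n * \<rho> 0 \<le> \<rho> k"
          by blast
        obtain j where j: "j \<ge> k" "\<not> P j"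
          using ex by blast
        have "\<gamma> ^ n * \<rho> 0 \<le> \<rho> j"
          using k incseqD[OF inc j(1)] by simp
        then have "\<gamma> ^ Suc n * \<rho> 0 \<le> \<rho> (Suc j)"
          using \<open>\<gamma> > 1\<close> j(2) by (simp add: step mult.assoc)
        then show ?case ..
      qed auto
      moreover obtain n where "B / \<rho> 0 < \<gamma> ^ n"
        using real_arch_pow[OF \<open>\<gamma> > 1\<close>] by blast
      then have "B < \<gamma> ^ n * \<rho> 0"
        using \<open>\<rho> 0 > 0\<close> by (simp add: pos_divide_less_eq)
      ultimately show False
        using B by (meson less_le_trans less_asym)
    qed
  qed
qed

text \<open>The contraction starts only at \<open>N\<close>, so the geometric majorant is applied to
  the sequence shifted by \<open>N\<close>.\<close>

lemma contraction_tendsto_0: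
  fixes V :: "nat \<Rightarrow> real"
  assumes "0 < \<tau>" "\<tau> < 1" and "\<And>k. V k \<ge> 0" and step: "\<And>k. k \<ge> N \<Longrightarrow> V (Suc k) \<le> \<tau> * V k"
  shows "V \<longlonglongrightarrow> 0"
proof -
  have "V (j + N) \<le> \<tau> ^ j * V N" for j
  proof (induction j)
    case (Suc j)
    have "V (Suc (j + N)) \<le> \<tau> * V (j + N)"
      by (rule step) simp
    also have "\<dots> \<le> \<tau> * (\<tau> ^ j * V N)"
      using Suc \<open>0 < \<tau>\<close> by simp
    finally show ?case
      by (simp add: mult.assoc)
  qed simp
  then have "\<forall>\<^sub>F j in sequentially. norm (V (j + N)) \<le> \<tau> ^ j * V N"
    by (simp add: assms(3))
  moreover have "(\<lambda>j. \<tau> ^ j * V N) \<longlonglongrightarrow> 0"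
    using assms by (intro tendsto_mult_left_zero LIMSEQ_realpow_zero) auto
  ultimately have "(\<lambda>j. V (j + N)) \<longlonglongrightarrow> 0"
    by (rule Lim_null_comparison)
  then show ?thesis
    by (rule LIMSEQ_offset)
qed

text \<open>This carries an inequality constraint to the weak limit, given a null sequence that
  eventually dominates the violation.\<close>

lemma weakly_seq_lsc_le_0:
  assumes "weakly_seq_lsc \<phi>" and "weakly_tendsto z l"
    and "\<And>n. \<phi> (z n) = ereal (s n)" and "\<forall>\<^sub>F n in sequentially. s n \<le> b n" and "b \<longlonglongrightarrow> 0"
  shows "\<phi> l \<le> 0"
proof -
  have "\<phi> l \<le> liminf (\<lambda>n. \<phi> (z n))"
    using assms(1,2) by (auto simp: weakly_seq_lsc_def)
  also have "\<dots> \<le> liminf (\<lambda>n. ereal (b n))"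
    using assms(3,4) by (intro Liminf_mono) simp
  also have "\<dots> = 0"
    using assms(5) by (intro lim_imp_Liminf) (auto simp: zero_ereal_def)
  finally show ?thesis .
qed

text \<open>Both parts of the penalty are nonnegative, so each is at most \<open>M\<close>. If
  \<open>G $ i\<close> > 0, then \<open>l $ i\<close> \<ge> 0 makes the truncated term at least
  \<open>\<rho> * G $ i\<close>, whence \<rho>/2 times the square of \<open>G $ i\<close> is at most
  \<open>M\<close>.\<close>

lemma penalty_bound_imp_infeasibility_bound:
  fixes G l :: "real ^ 'm::finite"
  assumes "\<rho> > 0" and "\<And>i. l $ i \<ge> 0"
    and bound: "1 / (2 * \<rho>) * (\<Sum>i\<in>UNIV. (max 0 (l $ i + \<rho> * G $ i))\<^sup>2) + \<rho> / 2 * (norm u)\<^sup>2 \<le> M"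
  shows "norm u \<le> sqrt (2 * M / \<rho>)" and "G $ i \<le> sqrt (2 * M / \<rho>)"
proof -
  let ?S = "1 / (2 * \<rho>) * (\<Sum>i\<in>UNIV. (max 0 (l $ i + \<rho> * G $ i))\<^sup>2)"
  have "?S \<ge> 0"
    using \<open>\<rho> > 0\<close> by (intro mult_nonneg_nonneg sum_nonneg) auto
  then have "\<rho> / 2 * (norm u)\<^sup>2 \<le> M"
    using bound by linarith
  then show u: "norm u \<le> sqrt (2 * M / \<rho>)"
    using \<open>\<rho> > 0\<close> by (intro real_le_rsqrt) (simp add: field_simps)
  show "G $ i \<le> sqrt (2 * M / \<rho>)"
  proof (cases "G $ i \<le> 0")
    case True
    then show ?thesis
      using u norm_ge_zero[of u] by linarith
  next
    case False
    have "(\<rho> * G $ i)\<^sup>2 \<le> (max 0 (l $ i + \<rho> * G $ i))\<^sup>2"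
      using False \<open>\<rho> > 0\<close> assms(2)[of i] by (intro power_mono) auto
    also have "\<dots> \<le> (\<Sum>i\<in>UNIV. (max 0 (l $ i + \<rho> * G $ i))\<^sup>2)"
      by (rule member_le_sum) auto
    finally have "1 / (2 * \<rho>) * (\<rho> * G $ i)\<^sup>2 \<le> ?S"
      using \<open>\<rho> > 0\<close> by (intro mult_left_mono) auto
    moreover have "0 \<le> \<rho> / 2 * (norm u)\<^sup>2"
      using \<open>\<rho> > 0\<close> by simp
    ultimately have "1 / (2 * \<rho>) * (\<rho> * G $ i)\<^sup>2 \<le> M"
      using bound by linarith
    then show ?thesis
      using \<open>\<rho> > 0\<close> by (intro real_le_rsqrt) (simp add: field_simps power2_eq_square)
  qed
qed

text \<open>With \<open>u\<close> = \<open>max G (- l / \<rho>)\<close>, the entry used in the error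
  measure, the truncation becomes \<open>l + \<rho> * u\<close>. The left side is then
  \<open>l * u\<close> plus a nonnegative square.\<close>

lemma penalty_term_ge:
  fixes \<rho> l G :: real
  assumes "\<rho> > 0"
  shows "1 / (2 * \<rho>) * ((max 0 (l + \<rho> * G))\<^sup>2 - l\<^sup>2) \<ge> l * max G (- l / \<rho>)"
proof -
  define u where "u = max G (- l / \<rho>)"
  have "max 0 (l + \<rho> * G) = l + \<rho> * u"
    using assms by (auto simp: u_def max_def field_simps)
  then have "1 / (2 * \<rho>) * ((max 0 (l + \<rho> * G))\<^sup>2 - l\<^sup>2) = l * u + \<rho> / 2 * u\<^sup>2"
    using assms by (simp add: field_simps power2_eq_square)
  then show ?thesis
    using assms by (simp add: u_def)
qed

theorem theorem2p8:
  fixes C :: "'a::banach set"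
    and f :: "'a \<Rightarrow> ereal"
    and g :: "'a \<Rightarrow> ereal ^ 'm::finite"
    and h :: "'a \<Rightarrow> 'b::{real_inner, complete_space}"
    and Bm :: "(real ^ 'm) set" and BY :: "'b set"
    and \<tau> \<gamma> :: real
    and x :: "nat \<Rightarrow> 'a" and v :: "nat \<Rightarrow> real ^ 'm" and w :: "nat \<Rightarrow> 'b"
    and \<rho> :: "nat \<Rightarrow> real" and \<epsilon> :: "nat \<Rightarrow> real"
    and r :: "nat \<Rightarrow> nat" and xbar :: 'a
  assumes "reflexive_space TYPE('a)"
    and "weakly_seq_closed C"
    and "avoids_minus_infinity f" and "weakly_seq_lsc f"
    and "\<And>i. avoids_minus_infinity (\<lambda>y. g y $ i)" and "\<And>i. weakly_seq_lsc (\<lambda>y. g y $ i)"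
    and "weakly_strongly_seq_continuous h"
    and "edom f \<inter> feasible_set C g h \<noteq> {}"
    and "bounded Bm" and "\<And>b i. b \<in> Bm \<Longrightarrow> b $ i \<ge> 0" and "bounded BY"
    and "0 < \<tau>" and "\<tau> < 1" and "\<gamma> > 1"
    and "safeguarded_alm_run C g h Bm BY \<tau> \<gamma> x v w \<rho>"
    and "\<And>k. \<epsilon> k \<ge> 0" and "\<epsilon> \<longlonglongrightarrow> 0"
    and "\<And>k y. y \<in> C \<Longrightarrow>
           aug_lagrangian f g h (\<rho> k) (x (Suc k)) (v k) (w k) - ereal (\<epsilon> k)
             \<le> aug_lagrangian f g h (\<rho> k) y (v k) (w k)"
    and "strict_mono r"
    and "weakly_tendsto (\<lambda>n. x (Suc (r n))) xbar"
  shows "(\<lambda>n. f (x (Suc (r n)))) \<longlonglongrightarrow> f xbar \<and>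
         xbar \<in> feasible_set C g h \<and>
         (\<forall>y \<in> feasible_set C g h. f xbar \<le> f y)"
proof -

  \<comment> \<open>The subproblem inequality in real numbers\<close>
  define F where "F k = real_of_ereal (f (x (Suc k)))" for k
  define G where "G k = (\<chi> i. real_of_ereal (g (x (Suc k)) $ i))" for k
  define z where "z n = x (Suc (r n))" for n
  define pen where
    "pen k = 1 / (2 * \<rho> k) * (\<Sum>i\<in>UNIV. (max 0 (v k $ i + \<rho> k * G k $ i))\<^sup>2 - (v k $ i)\<^sup>2)" for k
  \<comment> \<open>The disjunct \<open>k = 0\<close> settles the start, where the truncated
    difference \<open>k - 1\<close> would be 0 again.\<close>
  define P where "P k \<longleftrightarrow> k = 0 \<or> error_measure g h (\<rho> k) (x (Suc k)) (v k)
      \<le> ereal \<tau> * error_measure g h (\<rho> (k - 1)) (x k) (v (k - 1))" for k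
  note opt = assms(18)
  have weak: "weakly_tendsto z xbar"
    using assms(20) by (simp add: z_def[abs_def])
  have \<rho>0: "\<rho> 0 > 0" and step: "\<rho> (Suc k) = (if P k then \<rho> k else \<gamma> * \<rho> k)"
    and vB: "v k \<in> Bm" and wB: "w k \<in> BY" and xC: "x (Suc k) \<in> C" for k
    using assms(15) unfolding safeguarded_alm_run_def P_def by auto
  note \<rho>_cases = penalty_parameter_cases[OF \<rho>0 \<open>\<gamma> > 1\<close> step]
  have \<rho>_pos: "\<rho> k > 0" for k
    using \<rho>_cases(1)[of k] \<rho>0 by linarith
  have v_nonneg: "v k $ i \<ge> 0" for k i
    using assms(10) vB by blast
  obtain bv where bv: "\<And>k. norm (v k) \<le> bv"
    using \<open>bounded Bm\<close> vB by (auto simp: bounded_iff)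
  obtain bw where bw: "\<And>k. norm (w k) \<le> bw"
    using \<open>bounded BY\<close> wB by (auto simp: bounded_iff)
  have v_le: "\<bar>v k $ i\<bar> \<le> bv" for k i
    using component_le_norm_cart[of "v k" i] bv[of k] by linarith
  have f_ninf: "f y \<noteq> -\<infinity>" for y
    using assms(3) by (simp add: avoids_minus_infinity_def)
  have g_ninf: "g y $ i \<noteq> -\<infinity>" for y i
    using assms(5) by (simp add: avoids_minus_infinity_def)
  have f_real: "f y = ereal (real_of_ereal (f y))" if "y \<in> edom f" for y
    using that f_ninf[of y] by (cases "f y") (auto simp: edom_def)
  have L_le: "aug_lagrangian f g h (\<rho> k) (x (Suc k)) (v k) (w k) - ereal (\<epsilon> k) \<le> f y"
    if "y \<in> edom f" "y \<in> feasible_set C g h" for k y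
    using aug_lagrangian_feasible_le[where f = f and g = g and y = y and \<mu> = "w k" and l = "v k",
        OF \<rho>_pos[of k] that(2) f_real[OF that(1)] g_ninf[of y] v_nonneg[of k]]
      opt[of y k] that(2) by (auto simp: feasible_set_def intro: order_trans)
  \<comment> \<open>Comparison with one feasible point of finite objective value makes the
    Lagrangian finite at all iterates; the same point later enters the constant
    \<open>M\<close>.\<close>
  obtain y0 where y0: "y0 \<in> edom f" "y0 \<in> feasible_set C g h"
    using assms(8) by blast
  have L_fin: "aug_lagrangian f g h (\<rho> k) (x (Suc k)) (v k) (w k) \<noteq> \<infinity>" for k
    using L_le[OF y0, of k] y0(1) by (auto simp: edom_def)
  have F: "f (x (Suc k)) = ereal (F k)" for k
    using aug_lagrangian_finiteD(1)[OF \<rho>_pos f_ninf L_fin] f_ninf[of "x (Suc k)"]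
    by (cases "f (x (Suc k))") (auto simp: F_def)
  have G: "g (x (Suc k)) $ i = ereal (G k $ i)" for k i
    using aug_lagrangian_finiteD(2)[OF \<rho>_pos f_ninf L_fin, of k i] g_ninf[of "x (Suc k)" i]
    by (cases "g (x (Suc k)) $ i") (auto simp: G_def)
  have main: "F k + pen k + w k \<bullet> h (x (Suc k)) + \<rho> k / 2 * (norm (h (x (Suc k))))\<^sup>2
      \<le> real_of_ereal (f y) + \<epsilon> k"
    if "y \<in> edom f" "y \<in> feasible_set C g h" for k y
  proof -
    have "ereal (F k + pen k + w k \<bullet> h (x (Suc k)) + \<rho> k / 2 * (norm (h (x (Suc k))))\<^sup>2) - ereal (\<epsilon> k)
        \<le> ereal (real_of_ereal (f y))"
      using L_le[OF that, of k] f_real[OF that(1)]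
      unfolding aug_lagrangian_eq_real[of f "x (Suc k)" "F k" g "\<lambda>i. G k $ i", OF F G] pen_def
      by (metis (no_types))
    then show ?thesis
      by simp
  qed

  \<comment> \<open>Asymptotic feasibility and penalty bounds along the subsequence\<close>
  have h_lim: "(\<lambda>n. h (z n)) \<longlonglongrightarrow> h xbar"
    using assms(7) weak by (simp add: weakly_strongly_seq_continuous_def)
  have r_lim: "filterlim r sequentially sequentially"
    using \<open>strict_mono r\<close> by (rule filterlim_subseq)
  have f_liminf: "f xbar \<le> liminf (\<lambda>n. f (z n))"
    using assms(4) weak by (simp add: weakly_seq_lsc_def)
  have e_lim: "(\<lambda>n. \<epsilon> (r n)) \<longlonglongrightarrow> 0"
    using filterlim_compose[OF \<open>\<epsilon> \<longlonglongrightarrow> 0\<close> r_lim] .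
  \<comment> \<open>Common outcome of both cases: \<open>s\<close> dominates the constraint
    violation, \<open>d\<close> bounds the penalty from below, and both tend to 0. What follows does
    not depend on the behavior of \<rho>.\<close>
  have "\<exists>s d. (\<forall>\<^sub>F n in sequentially. norm (h (z n)) \<le> s n \<and> (\<forall>i. G (r n) $ i \<le> s n) \<and> d n \<le> pen (r n))
      \<and> s \<longlonglongrightarrow> 0 \<and> d \<longlonglongrightarrow> (0::real)"
    using \<rho>_cases(2)
  proof
    assume "\<exists>N. \<forall>k\<ge>N. P k"
    then obtain N where N: "\<And>k. k \<ge> N \<Longrightarrow> P k"
      by blast
    define U where "U k = (\<chi> i. max (G k $ i) (- (v k $ i) / \<rho> k))" for k
    define V where "V k = max (infnorm (U k)) (norm (h (x (Suc k))))" for k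
    have V: "error_measure g h (\<rho> k) (x (Suc k)) (v k) = ereal (V k)" for k
      by (simp add: error_measure_def V_def U_def edom_vec_def edom_def G)
    have "V \<longlonglongrightarrow> 0"
    proof (rule contraction_tendsto_0[OF \<open>0 < \<tau>\<close> \<open>\<tau> < 1\<close>])
      show "V k \<ge> 0" for k
        by (simp add: V_def le_max_iff_disj)
      \<comment> \<open>The test at \<open>Suc k\<close>, not at \<open>k\<close>, compares
        \<open>V (Suc k)\<close> with \<open>V k\<close>, and its index is never 0.\<close>
      show "V (Suc k) \<le> \<tau> * V k" if "k \<ge> N" for k
        using N[of "Suc k"] that V[of k] V[of "Suc k"] by (simp add: P_def)
    qed
    then have V_lim: "(\<lambda>n. V (r n)) \<longlonglongrightarrow> 0"
      by (rule filterlim_compose[OF _ r_lim])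
    have U_le: "\<bar>U k $ i\<bar> \<le> V k" for k i
      using component_le_infnorm_cart[of "U k" i] by (simp add: V_def)
    have G_le: "G k $ i \<le> V k" for k i
      using U_le[of k i] by (simp add: U_def)
    have pen_ge: "- (real CARD('m) * (bv * V k)) \<le> pen k" for k
    proof -
      have "- (bv * V k) \<le> 1 / (2 * \<rho> k) * ((max 0 (v k $ i + \<rho> k * G k $ i))\<^sup>2 - (v k $ i)\<^sup>2)" for i
      proof -
        have "\<bar>v k $ i * U k $ i\<bar> \<le> bv * V k"
          unfolding abs_mult using v_le[of k i] U_le[of k i] by (intro mult_mono) auto
        then show ?thesis
          using penalty_term_ge[OF \<rho>_pos[of k], where l = "v k $ i" and G = "G k $ i"] by (simp add: U_def)
      qed
      then have "(\<Sum>i\<in>(UNIV :: 'm set). - (bv * V k)) \<le> pen k"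
        unfolding pen_def sum_distrib_left by (rule sum_mono)
      then show ?thesis
        by simp
    qed
    have "(\<lambda>n. - (real CARD('m) * (bv * V (r n)))) \<longlonglongrightarrow> - (real CARD('m) * (bv * 0))"
      by (intro tendsto_intros V_lim)
    then show ?thesis
      using V_lim G_le pen_ge
      by (intro exI[of _ "\<lambda>n. V (r n)"] exI[of _ "\<lambda>n. - (real CARD('m) * (bv * V (r n)))"])
        (auto simp: z_def V_def)
  next
    assume "filterlim \<rho> at_top sequentially"
    then have R_lim: "filterlim (\<lambda>n. \<rho> (r n)) at_top sequentially"
      by (rule filterlim_compose[OF _ r_lim])
    \<comment> \<open>\<open>f xbar\<close> may still be infinite here, so a real \<open>c\<close>
      below it is chosen. Lower semicontinuity makes \<open>c\<close> an eventual lower bound of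
      \<open>F\<close> along the subsequence, in place of a global lower bound of
      \<open>f\<close>.\<close>
    obtain c where c: "ereal c < f xbar"
      using ereal_dense2[of "-\<infinity>" "f xbar"] f_ninf[of xbar] by auto
    have F_ge: "\<forall>\<^sub>F n in sequentially. c < F (r n)"
      using less_LiminfD[OF less_le_trans[OF c f_liminf]] by (simp add: z_def F)
    obtain bh where bh: "\<And>n. norm (h (z n)) \<le> bh"
      using convergent_imp_Bseq[OF convergentI[OF h_lim]] by (auto simp: Bseq_def)
    obtain be where be: "\<And>n. \<bar>\<epsilon> (r n)\<bar> \<le> be"
      using convergent_imp_Bseq[OF convergentI[OF e_lim]] by (auto simp: Bseq_def)
    define bs where "bs = real CARD('m) * bv\<^sup>2"
    have v2: "(\<Sum>i\<in>UNIV. (v k $ i)\<^sup>2) \<le> bs" for k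
    proof -
      have "(\<Sum>i\<in>UNIV. (v k $ i)\<^sup>2) \<le> (\<Sum>i\<in>(UNIV :: 'm set). bv\<^sup>2)"
        using v_le by (intro sum_mono) (metis abs_ge_zero power2_abs power_mono)
      then show ?thesis
        by (simp add: bs_def)
    qed
    have v2\<rho>: "1 / (2 * \<rho> k) * (\<Sum>i\<in>UNIV. (v k $ i)\<^sup>2) \<le> 1 / (2 * \<rho> k) * bs" for k
      using v2 \<rho>_pos[of k] by (intro mult_left_mono) auto
    have pen_eq: "pen k = 1 / (2 * \<rho> k) * (\<Sum>i\<in>UNIV. (max 0 (v k $ i + \<rho> k * G k $ i))\<^sup>2)
        - 1 / (2 * \<rho> k) * (\<Sum>i\<in>UNIV. (v k $ i)\<^sup>2)" for k
      unfolding pen_def sum_subtractf right_diff_distrib ..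
    have pen_ge: "- (1 / (2 * \<rho> k) * bs) \<le> pen k" for k
    proof -
      have "0 \<le> 1 / (2 * \<rho> k) * (\<Sum>i\<in>UNIV. (max 0 (v k $ i + \<rho> k * G k $ i))\<^sup>2)"
        using \<rho>_pos[of k] by (intro mult_nonneg_nonneg sum_nonneg) auto
      then show ?thesis
        using pen_eq[of k] v2\<rho>[of k] by linarith
    qed
    \<comment> \<open>Obtained by solving \<open>main\<close> at \<open>y0\<close> for the
      nonnegative penalty terms: \<open>c\<close> bounds \<open>F\<close> from below,
      \<open>bw * bh\<close> controls the inner product, and the last summand bounds the subtracted
      squares of \<open>v\<close>, since \<rho> never falls below its initial value.\<close>
    define M where "M = real_of_ereal (f y0) + be - c + bw * bh + 1 / (2 * \<rho> 0) * bs"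
    let ?s = "\<lambda>n. sqrt (2 * M / \<rho> (r n))"
    have bound: "1 / (2 * \<rho> k) * (\<Sum>i\<in>UNIV. (max 0 (v k $ i + \<rho> k * G k $ i))\<^sup>2)
        + \<rho> k / 2 * (norm (h (z n)))\<^sup>2 \<le> M" if "c < F k" and k: "k = r n" for n k
    proof -
      have "\<bar>w k \<bullet> h (z n)\<bar> \<le> norm (w k) * norm (h (z n))"
        by (rule Cauchy_Schwarz_ineq2)
      also have "\<dots> \<le> bw * bh"
        using bw bh by (intro mult_mono) (auto intro: order_trans[OF norm_ge_zero])
      finally have "- (bw * bh) \<le> w k \<bullet> h (z n)"
        by linarith
      moreover have "1 / (2 * \<rho> k) * bs \<le> 1 / (2 * \<rho> 0) * bs"
        using \<rho>_cases(1)[of k] \<rho>0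
        by (intro mult_right_mono) (auto simp: bs_def divide_simps)
      ultimately show ?thesis
        using main[OF y0, of k] be[of n] that v2\<rho>[of k] unfolding pen_eq M_def k z_def by linarith
    qed
    have "\<forall>\<^sub>F n in sequentially. norm (h (z n)) \<le> ?s n \<and> (\<forall>i. G (r n) $ i \<le> ?s n)
        \<and> - (1 / (2 * \<rho> (r n)) * bs) \<le> pen (r n)"
      using F_ge
    proof eventually_elim
      case (elim n)
      show ?case
        using penalty_bound_imp_infeasibility_bound[OF \<rho>_pos v_nonneg bound[OF elim refl]] pen_ge
        by auto
    qed
    moreover have inv_lim: "(\<lambda>n. a / \<rho> (r n)) \<longlonglongrightarrow> 0" for a
      using tendsto_divide_0[OF tendsto_const filterlim_at_top_imp_at_infinity[OF R_lim]] .
    have "?s \<longlonglongrightarrow> sqrt 0"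
      by (intro tendsto_real_sqrt inv_lim)
    moreover have "(\<lambda>n. - (1 / (2 * \<rho> (r n)) * bs)) \<longlonglongrightarrow> 0"
      using inv_lim[of "- bs / 2"] by simp
    ultimately show ?thesis
      by (intro exI[of _ ?s] exI[of _ "\<lambda>n. - (1 / (2 * \<rho> (r n)) * bs)"]) simp
  qed
  then obtain s d where ev: "\<forall>\<^sub>F n in sequentially. norm (h (z n)) \<le> s n \<and> (\<forall>i. G (r n) $ i \<le> s n) \<and> d n \<le> pen (r n)"
    and s: "s \<longlonglongrightarrow> 0" and d: "d \<longlonglongrightarrow> (0::real)"
    by blast

  \<comment> \<open>Feasibility and optimality of the weak limit\<close>
  have h0: "(\<lambda>n. h (z n)) \<longlonglongrightarrow> 0"
    using ev by (intro Lim_null_comparison[OF _ s]) (auto elim: eventually_mono)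
  have feas: "xbar \<in> feasible_set C g h"
  proof -
    have "xbar \<in> C"
      using assms(2)[unfolded weakly_seq_closed_def, rule_format, OF _ weak] xC by (simp add: z_def)
    moreover have "h xbar = 0"
      using LIMSEQ_unique[OF h_lim h0] .
    moreover have "g xbar $ i \<le> 0" for i
      by (rule weakly_seq_lsc_le_0[OF assms(6) weak _ _ s, of _ "\<lambda>n. G (r n) $ i"])
        (use ev in \<open>auto simp: z_def G elim: eventually_mono\<close>)
    ultimately show ?thesis
      by (simp add: feasible_set_def)
  qed
  have limsup: "limsup (\<lambda>n. f (z n)) \<le> f y" if y: "y \<in> edom f" "y \<in> feasible_set C g h" for y
  proof -
    \<comment> \<open>\<open>main\<close> solved for \<open>F\<close>: \<open>pen\<close> is
      replaced by \<open>d\<close>, the inner product is estimated by Cauchy-Schwarz, and the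
      nonnegative quadratic term in \<open>h\<close> is dropped. As \<open>h\<close> tends to 0, so
      does the multiplier term, and \<open>b\<close> tends to the value at \<open>y\<close>.\<close>
    define b where "b n = real_of_ereal (f y) + \<epsilon> (r n) - d n + bw * norm (h (z n))" for n
    have "\<forall>\<^sub>F n in sequentially. f (z n) \<le> ereal (b n)"
      using ev
    proof eventually_elim
      case (elim n)
      have "\<bar>w (r n) \<bullet> h (z n)\<bar> \<le> norm (w (r n)) * norm (h (z n))"
        by (rule Cauchy_Schwarz_ineq2)
      also have "\<dots> \<le> bw * norm (h (z n))"
        using bw by (intro mult_right_mono) auto
      finally have "- (bw * norm (h (z n))) \<le> w (r n) \<bullet> h (z n)"
        by linarith
      moreover have "0 \<le> \<rho> (r n) / 2 * (norm (h (z n)))\<^sup>2"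
        using \<rho>_pos[of "r n"] by simp
      ultimately have "F (r n) \<le> b n"
        using main[OF y, of "r n"] elim unfolding b_def z_def by linarith
      then show ?case
        by (simp add: z_def F)
    qed
    then have "limsup (\<lambda>n. f (z n)) \<le> limsup (\<lambda>n. ereal (b n))"
      by (rule Limsup_mono)
    also have "b \<longlonglongrightarrow> real_of_ereal (f y) + 0 - 0 + bw * norm (0::'b)"
      unfolding b_def by (intro tendsto_intros e_lim d h0)
    then have "limsup (\<lambda>n. ereal (b n)) = ereal (real_of_ereal (f y))"
      by (intro lim_imp_Limsup) auto
    finally show ?thesis
      using f_real[OF y(1)] by simp
  qed
  have li_ls: "liminf (\<lambda>n. f (z n)) \<le> limsup (\<lambda>n. f (z n))"
    by (rule Liminf_le_Limsup) simp
  \<comment> \<open>Points outside \<open>edom f\<close> have value \<infinity> and are trivial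
    competitors.\<close>
  have min: "f xbar \<le> f y" if "y \<in> feasible_set C g h" for y
    using limsup[of y] that f_liminf li_ls by (cases "y \<in> edom f") (auto simp: edom_def)
  \<comment> \<open>Comparison with \<open>y0\<close> makes \<open>f xbar\<close> finite, so
    \<open>limsup\<close> applies with \<open>xbar\<close> itself as the competitor. This squeezes
    liminf and limsup to \<open>f xbar\<close>.\<close>
  then have "xbar \<in> edom f"
    using y0 by (auto simp: edom_def intro: le_less_trans)
  then have "(\<lambda>n. f (z n)) \<longlonglongrightarrow> f xbar"
    using limsup[OF _ feas] f_liminf li_ls by (intro Liminf_eq_Limsup) (auto intro: antisym)
  then show ?thesis
    using feas min by (simp add: z_def)
qed

end
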